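(* Let $\{Y_n: n\ge 1\}$ be a sequence of independent random variables and $S_n=Y_1+\cdots+Y_n$. Let $(d_n)$ be a sequence of positive numbers such that $$\frac{d_l}{d_k}\gg\left(\frac lk\right)^{\gamma}\qquad (l\ge k\ge n_0)$$ for some $\gamma>0$ and $n_0\ge 1$, and $$\mathbb{E}\left|\frac{S_n-\mu n}{d_n}\right|\ll e^{\gamma'(\log n)^{1-\varepsilon}}$$ for some constant $\mu$, some $\gamma'\in(0,\gamma)$ and some $\varepsilon>0$. Then for every $t\in[0,1]$ and every distribution function $G_t$ on $\mathbb{R}$, the following two statements are equivalent: (i) for every continuity point $x$ of $G_t$, $$\frac{1}{\log N}\sum_{n=1}^N\frac1n\,\mathbf{I}\left(\frac1{d_n}\sum_{k=1}^{[nt]}\left(\frac{S_k}{k}-\mu\right)\le x\right)\longrightarrow G_t(x)\quad\text{almost surely as }N\to\infty;$$ (ii) for every continuity point $x$ of $G_t$, $$\frac{1}{\log N}\sum_{n=1}^N\frac1n\,\mathbb{P}\left(\frac1{d_n}\sum_{k=1}^{[nt]}\left(\frac{S_k}{k}-\mu\right)\le x\right)\longrightarrow G_t(x)\quad\text{as }N\to\infty.$$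
   Context: $\mathbf{I}(A)$ denotes the indicator function of the event $A$; $[nt]$ denotes the integer part of $nt$; an empty sum equals $0$. Throughout, $\log x$ stands for $\ln(\max\{x,e\})$. The notation $a_n\ll b_n$ means $a_n=O(b_n)$, and $a\gg b$ means $b\ll a$; thus the first condition says there is a constant $c>0$ with $d_l/d_k\ge c\,(l/k)^\gamma$ for all integers $l\ge k\ge n_0$, and the second says that there is a constant $C$ such that the expectation is at most $C e^{\gamma'(\log n)^{1-\varepsilon}}$ for all $n\ge 1$. *)

theory Defs
  imports "HOL-Probability.Probability"
begin

text \<open>Natural logarithm truncated below: its value is at least 1 everywhere, so dividing by it
  is always meaningful.\<close>

definition tlog :: "real \<Rightarrow> real" where
  "tlog x = ln (max x (exp 1))"

text \<open>The sequence is indexed from 1; \<open>Y 0\<close> is never used.\<close>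

definition partial_sum :: "(nat \<Rightarrow> 'a \<Rightarrow> real) \<Rightarrow> nat \<Rightarrow> 'a \<Rightarrow> real" where
  "partial_sum Y n \<omega> = (\<Sum>i=1..n. Y i \<omega>)"

text \<open>The integer part of \<open>n t\<close> is taken as a natural number, which is harmless for \<open>t \<ge> 0\<close>.\<close>

definition normalized_mean_sum ::
  "(nat \<Rightarrow> 'a \<Rightarrow> real) \<Rightarrow> real \<Rightarrow> (nat \<Rightarrow> real) \<Rightarrow> real \<Rightarrow> nat \<Rightarrow> 'a \<Rightarrow> real" where
  "normalized_mean_sum Y \<mu> d t n \<omega> =
     1 / d n * (\<Sum>k=1..nat \<lfloor>real n * t\<rfloor>. (partial_sum Y k \<omega> / real k - \<mu>))"

definition log_average :: "(nat \<Rightarrow> real) \<Rightarrow> nat \<Rightarrow> real" where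
  "log_average a N = 1 / tlog (real N) * (\<Sum>n=1..N. 1 / real n * a n)"

end

theory Submission
  imports Defs
begin

text \<open>
Write \<open>X n\<close> for the normalized sum of means at time \<open>n\<close>. The two statements are equivalent because the
logarithmic averages of \<open>f (X n)\<close> and of the expectations of \<open>f (X n)\<close> differ by a sequence tending to
0 almost surely, for every bounded Lipschitz function \<open>f\<close>. Taking for \<open>f\<close> functions that descend from
1 to 0 on a short interval, one compares averaged empirical frequencies with averaged
probabilities, up to a small shift of the argument, and such a shift is invisible at continuity points
of \<open>G\<close>. The comparison is symmetric in the two averages, so one argument gives both implications
(\<open>tendsto_of_shifted_asymp_le\<close>).

The strong law for \<open>f (X n)\<close> is a second moment argument. For \<open>k < l\<close>, the variables on
which \<open>X k\<close> depends contribute to \<open>X l\<close> only the means up to time \<open>k * t\<close> and the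
partial sum reached at that time, which lingers in all later means with weights \<open>1 / j\<close>. In \<open>L\<^sup>1\<close> this
contribution is at most a constant times
\<open>(k / l) powr \<gamma> * exp (\<gamma>' * T powr (1 - \<epsilon>)) * T\<close>, where \<open>T = tlog N\<close> and \<open>l \<le> N\<close>, and it bounds the covariance of
\<open>f (X k)\<close> and \<open>f (X l)\<close>, because what is left of \<open>X l\<close> is independent of \<open>X k\<close>
(\<open>abs_covariance_le_of_decoupling\<close>). So the covariance is \<open>O(1 / T)\<close> unless \<open>ln l - ln k\<close> is at
most of order \<open>T powr (1 - \<epsilon>)\<close>. As the weights \<open>1 / n\<close> turn sums into lengths on the logarithmic scale, the
double sum of the weighted covariances is \<open>O(T powr (2 - \<epsilon>))\<close>
(\<open>second_moment_le_of_decorrelation\<close>). Dividing by \<open>T\<^sup>2\<close> leaves a negative power of \<open>ln N\<close>, which is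
summable along a subsequence sparse enough for convergence but dense enough, on the logarithmic scale,
to control all \<open>N\<close> (\<open>AE_log_average_tendsto_0\<close>). For this outline \<open>\<epsilon> < 1\<close>; larger \<open>\<epsilon>\<close>
reduce to this case.
\<close>

section \<open>Harmonic sums and logarithmic averages\<close>

lemma tlog_ge_1: "1 \<le> tlog x"
proof -
  have "0 < max x (exp 1)" by (rule less_le_trans[OF exp_gt_zero max.cobounded2])
  then show ?thesis unfolding tlog_def by (simp add: ln_ge_iff)
qed

lemma tlog_pos: "0 < tlog x"
  using tlog_ge_1[of x] by linarith

lemma ln_le_tlog: "0 < x \<Longrightarrow> ln x \<le> tlog x"
  unfolding tlog_def by (auto simp: max_def)

lemma tlog_mono: "x \<le> y \<Longrightarrow> tlog x \<le> tlog y"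
  unfolding tlog_def
  by (intro ln_mono max.mono order_refl less_le_trans[OF exp_gt_zero max.cobounded2])

lemma tlog_powr_mono: "p \<le> q \<Longrightarrow> tlog x powr p \<le> tlog x powr q"
  by (intro powr_mono tlog_ge_1)

lemma harmonic_segment_le_ln:
  assumes "1 \<le> p" "p \<le> q"
  shows "(\<Sum>n\<in>{p<..q}. 1 / real n) \<le> ln (real q) - ln (real p)"
  using assms(2)
proof (induction q rule: dec_induct)
  case base
  then show ?case by simp
next
  case (step n)
  have n: "0 < n" using step.hyps assms(1) by linarith
  have "{p<..Suc n} = insert (Suc n) {p<..n}" using step.hyps by auto
  moreover have "1 / real (Suc n) \<le> ln (real (Suc n)) - ln (real n)"
  proof -
    have "ln (real n / real (Suc n)) \<le> real n / real (Suc n) - 1"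
      using n by (intro ln_le_minus_one) auto
    also have "\<dots> = - (1 / real (Suc n))" by (simp add: field_simps)
    finally show ?thesis using n by (simp add: ln_div)
  qed
  ultimately show ?case using step.IH by simp
qed

text \<open>The weights \<open>1 / n\<close> measure length on the logarithmic scale: whatever the shape of the index set,
only its diameter on that scale counts, up to the weight of its first element. This form needs no
rounding when the index set is a logarithmic neighbourhood of a given index.\<close>

lemma harmonic_sum_le_spread:
  assumes "finite A" "\<And>n. n \<in> A \<Longrightarrow> 1 \<le> n" "0 \<le> r"
    and spread: "\<And>k l. k \<in> A \<Longrightarrow> l \<in> A \<Longrightarrow> ln (real l) - ln (real k) \<le> r"
  shows "(\<Sum>n\<in>A. 1 / real n) \<le> 1 + r"
proof (cases "A = {}")
  case False
  define p q where "p = Min A" and "q = Max A"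
  have pq: "p \<in> A" "q \<in> A" "p \<le> q"
    using False assms(1) by (auto simp: p_def q_def)
  have "A \<subseteq> insert p {p<..q}"
    using assms(1) by (force simp: p_def q_def order_less_le)
  then have "(\<Sum>n\<in>A. 1 / real n) \<le> (\<Sum>n\<in>insert p {p<..q}. 1 / real n)"
    by (intro sum_mono2) auto
  also have "\<dots> = 1 / real p + (\<Sum>n\<in>{p<..q}. 1 / real n)" by simp
  also have "\<dots> \<le> 1 + (ln (real q) - ln (real p))"
    using assms(2)[OF pq(1)] pq by (intro add_mono harmonic_segment_le_ln) auto
  also have "\<dots> \<le> 1 + r" using spread[OF pq(1,2)] by simp
  finally show ?thesis .
qed (use assms in auto)

lemma harmonic_sum_le_tlog: "(\<Sum>n=1..N. 1 / real n) \<le> 2 * tlog (real N)"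
proof (cases "N = 0")
  case False
  have "(\<Sum>n=1..N. 1 / real n) \<le> 1 + ln (real N)"
  proof (rule harmonic_sum_le_spread)
    fix k l assume kl: "k \<in> {1..N}" "l \<in> {1..N}"
    then have "ln (real l) \<le> ln (real N)" "0 \<le> ln (real k)" by auto
    then show "ln (real l) - ln (real k) \<le> ln (real N)" by linarith
  qed (use False in auto)
  also have "\<dots> \<le> 2 * tlog (real N)"
    using tlog_ge_1[of "real N"] ln_le_tlog[of "real N"] False by simp
  finally show ?thesis .
qed (use tlog_ge_1[of 0] in simp)

lemma log_average_mono:
  "(\<And>n. 1 \<le> n \<Longrightarrow> a n \<le> b n) \<Longrightarrow> log_average a N \<le> log_average b N"
  unfolding log_average_def
  by (intro mult_left_mono sum_mono) (auto simp: tlog_pos less_imp_le)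

lemma log_average_diff:
  "log_average (\<lambda>n. a n - b n) N = log_average a N - log_average b N"
  unfolding log_average_def
  by (simp add: right_diff_distrib diff_divide_distrib sum_subtractf flip: sum_distrib_left)

text \<open>Control along a sparse subsequence suffices: logarithmic averages of a bounded sequence move by
at most the logarithmic distance of the two end points divided by the logarithm of the smaller one.\<close>

lemma abs_log_average_gap:
  assumes bnd: "\<And>n. \<bar>a n\<bar> \<le> 1" and "1 \<le> K" "K \<le> N"
  shows "\<bar>log_average a N\<bar>
    \<le> \<bar>log_average a K\<bar> + (ln (real N) - ln (real K)) / tlog (real K)"
proof -
  define s where "s m = (\<Sum>n=1..m. 1 / real n * a n)" for m
  define r where "r = (\<Sum>n\<in>{K<..N}. 1 / real n * a n)"
  have "{1..N} = {1..K} \<union> {K<..N}" using assms by auto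
  then have "s N = s K + r"
    unfolding s_def r_def by (simp add: sum.union_disjoint ivl_disj_int)
  moreover have "\<bar>r\<bar> \<le> ln (real N) - ln (real K)"
  proof -
    have "\<bar>r\<bar> \<le> (\<Sum>n\<in>{K<..N}. \<bar>1 / real n * a n\<bar>)" unfolding r_def by (rule sum_abs)
    also have "\<dots> \<le> (\<Sum>n\<in>{K<..N}. 1 / real n)"
      using bnd by (intro sum_mono) (auto simp: abs_mult divide_right_mono)
    also have "\<dots> \<le> ln (real N) - ln (real K)"
      using assms by (intro harmonic_segment_le_ln)
    finally show ?thesis .
  qed
  ultimately have "\<bar>s N\<bar> \<le> \<bar>s K\<bar> + (ln (real N) - ln (real K))" by linarith
  moreover have "0 < tlog (real K)" "tlog (real K) \<le> tlog (real N)"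
    using assms by (auto simp: tlog_pos intro: tlog_mono)
  ultimately have "\<bar>s N\<bar> / tlog (real N) \<le> (\<bar>s K\<bar> + (ln (real N) - ln (real K))) / tlog (real K)"
    by (intro frac_le) auto
  then show ?thesis
    using tlog_pos[of "real N"] tlog_pos[of "real K"]
    by (simp add: log_average_def s_def abs_mult add_divide_distrib)
qed

section \<open>Almost sure convergence from second moments\<close>

lemma (in prob_space) AE_tendsto_0_of_summable_expectation:
  fixes Z :: "nat \<Rightarrow> 'a \<Rightarrow> real"
  assumes meas: "\<And>i. Z i \<in> borel_measurable M" and nonneg: "\<And>i \<omega>. 0 \<le> Z i \<omega>"
    and int: "\<And>i. integrable M (Z i)" and sm: "summable (\<lambda>i. expectation (Z i))"
  shows "AE \<omega> in M. (\<lambda>i. Z i \<omega>) \<longlonglongrightarrow> 0"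
proof -
  note [measurable] = meas
  have "(\<integral>\<^sup>+ \<omega>. (\<Sum>i. ennreal (Z i \<omega>)) \<partial>M) = (\<Sum>i. \<integral>\<^sup>+ \<omega>. ennreal (Z i \<omega>) \<partial>M)"
    by (rule nn_integral_suminf) simp
  also have "\<dots> = (\<Sum>i. ennreal (expectation (Z i)))"
    by (intro suminf_cong nn_integral_eq_integral int) (simp add: nonneg)
  also have "\<dots> = ennreal (\<Sum>i. expectation (Z i))"
    by (intro suminf_ennreal2 sm) (simp add: nonneg)
  finally have "(\<integral>\<^sup>+ \<omega>. (\<Sum>i. ennreal (Z i \<omega>)) \<partial>M) \<noteq> \<infinity>" by simp
  then have "AE \<omega> in M. (\<Sum>i. ennreal (Z i \<omega>)) \<noteq> \<infinity>"
    by (intro nn_integral_PInf_AE) auto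
  then show ?thesis
  proof eventually_elim
    case (elim \<omega>)
    then have "summable (\<lambda>i. Z i \<omega>)"
      by (intro summable_suminf_not_top) (auto simp: nonneg)
    then show ?case by (rule summable_LIMSEQ_zero)
  qed
qed

text \<open>The second moment of the logarithmic average is at most of order \<open>T powr - \<epsilon>\<close>, where \<open>T = tlog N\<close>. This is
summable along indices \<open>K i\<close> with \<open>ln (K i)\<close> close to \<open>i powr (2 / \<epsilon>)\<close>, so the averages tend to 0
almost surely there. As \<open>ln (K (i + 1)) / ln (K i)\<close> tends to 1, the gaps are harmless by \<open>abs_log_average_gap\<close>.\<close>

lemma (in prob_space) AE_log_average_tendsto_0:
  fixes \<xi> :: "nat \<Rightarrow> 'a \<Rightarrow> real"
  assumes meas: "\<And>n. \<xi> n \<in> borel_measurable M" and bnd: "\<And>n \<omega>. \<bar>\<xi> n \<omega>\<bar> \<le> 1"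
    and \<epsilon>: "0 < \<epsilon>"
    and second_moment: "\<And>N. 1 \<le> N \<Longrightarrow>
      expectation (\<lambda>\<omega>. (\<Sum>n=1..N. 1 / real n * \<xi> n \<omega>)\<^sup>2) \<le> C * tlog (real N) powr (2 - \<epsilon>)"
  shows "AE \<omega> in M. log_average (\<lambda>n. \<xi> n \<omega>) \<longlonglongrightarrow> 0"
proof -
  note [measurable] = meas
  define p where "p = 2 / \<epsilon>"
  have p: "0 < p" "p * \<epsilon> = 2" using \<epsilon> by (auto simp: p_def)
  \<comment> \<open>Rounding up gives \<open>ln (K i) \<ge> i powr p\<close> without loss, and \<open>K i \<le> N\<close> still follows from
    \<open>exp (i powr p) \<le> N\<close> because \<open>N\<close> is an integer.\<close>
  define K where "K i = nat \<lceil>exp (real i powr p)\<rceil>" for i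
  have K_ge: "exp (real i powr p) \<le> real (K i)" for i
    unfolding K_def by linarith
  have K_pos: "0 < real (K i)" for i
    using K_ge[of i] exp_gt_zero[of "real i powr p"] by linarith
  have ln_K: "real i powr p \<le> ln (real (K i))" for i
    using K_ge K_pos by (simp add: ln_ge_iff)
  have tlog_K: "real i powr p \<le> tlog (real (K i))" for i
    using ln_K[of i] ln_le_tlog[OF K_pos[of i]] by linarith
  define s where "s i \<omega> = log_average (\<lambda>n. \<xi> n \<omega>) (K i)" for i \<omega>
  have [measurable]: "s i \<in> borel_measurable M" for i
    unfolding s_def log_average_def by measurable
  have s_bnd: "\<bar>s i \<omega>\<bar> \<le> 2" for i \<omega>
  proof -
    have "\<bar>\<Sum>n=1..K i. 1 / real n * \<xi> n \<omega>\<bar> \<le> (\<Sum>n=1..K i. \<bar>1 / real n * \<xi> n \<omega>\<bar>)"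
      by (rule sum_abs)
    also have "\<dots> \<le> (\<Sum>n=1..K i. 1 / real n)"
      using bnd by (intro sum_mono) (auto simp: abs_mult divide_right_mono)
    also have "\<dots> \<le> 2 * tlog (real (K i))" by (rule harmonic_sum_le_tlog)
    finally show ?thesis
      using tlog_pos[of "real (K i)"]
      by (simp add: s_def log_average_def abs_mult field_simps)
  qed
  have "(s i \<omega>)\<^sup>2 \<le> 2\<^sup>2" for i \<omega>
    using power_mono[OF s_bnd[of i \<omega>], of 2] by simp
  then have int: "integrable M (\<lambda>\<omega>. (s i \<omega>)\<^sup>2)" for i
    by (intro integrable_const_bound[where B = "2\<^sup>2"]) auto
  have s_moment: "expectation (\<lambda>\<omega>. (s i \<omega>)\<^sup>2) \<le> \<bar>C\<bar> * real i powr (-2)" if i: "1 \<le> i" for i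
  proof -
    let ?T = "tlog (real (K i))"
    have T: "0 < ?T" by (rule tlog_pos)
    have "expectation (\<lambda>\<omega>. (s i \<omega>)\<^sup>2)
        = (1 / ?T\<^sup>2) * expectation (\<lambda>\<omega>. (\<Sum>n=1..K i. 1 / real n * \<xi> n \<omega>)\<^sup>2)"
      unfolding s_def log_average_def by (simp add: power_mult_distrib power_divide)
    also have "\<dots> \<le> (1 / ?T\<^sup>2) * (C * ?T powr (2 - \<epsilon>))"
      using K_pos[of i] T by (intro mult_left_mono second_moment) auto
    also have "\<dots> = C * ?T powr (- \<epsilon>)"
    proof -
      have "?T powr (2 - \<epsilon>) = ?T\<^sup>2 * ?T powr (- \<epsilon>)"
        using T by (simp add: powr_diff powr_minus divide_inverse)
      then show ?thesis using T by simp
    qed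
    also have "\<dots> \<le> \<bar>C\<bar> * ?T powr (- \<epsilon>)" by (intro mult_right_mono) auto
    also have "\<dots> \<le> \<bar>C\<bar> * (real i powr p) powr (- \<epsilon>)"
      using \<epsilon> i tlog_K[of i] by (intro mult_left_mono powr_mono2') auto
    also have "\<dots> = \<bar>C\<bar> * real i powr (-2)"
      using p by (simp add: powr_powr)
    finally show ?thesis .
  qed
  have "summable (\<lambda>i. expectation (\<lambda>\<omega>. (s i \<omega>)\<^sup>2))"
  proof (rule summable_comparison_test_ev)
    show "\<forall>\<^sub>F i in sequentially. norm (expectation (\<lambda>\<omega>. (s i \<omega>)\<^sup>2)) \<le> \<bar>C\<bar> * real i powr (-2)"
      by (intro eventually_sequentiallyI[of 1]) (use s_moment in simp)
    show "summable (\<lambda>i. \<bar>C\<bar> * real i powr (-2))"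
      by (intro summable_mult) (simp add: summable_real_powr_iff)
  qed
  then have "AE \<omega> in M. (\<lambda>i. (s i \<omega>)\<^sup>2) \<longlonglongrightarrow> 0"
    by (intro AE_tendsto_0_of_summable_expectation int) auto
  then show ?thesis
  proof eventually_elim
    case (elim \<omega>)
    have s_lim: "(\<lambda>i. s i \<omega>) \<longlonglongrightarrow> 0"
      using tendsto_real_sqrt[OF elim] by (simp add: tendsto_rabs_zero_iff)
    define h where "h i = \<bar>s i \<omega>\<bar> + ((1 + 1 / real i) powr p - 1)" for i
    \<comment> \<open>The index of the subsequence element just below \<open>N\<close>: \<open>i powr p \<le> ln N < (i + 1) powr p\<close>.\<close>
    define i where "i N = nat \<lfloor>ln (real N) powr (1 / p)\<rfloor>" for N
    have "(\<lambda>i. (1 + 1 / real i) powr p - 1) \<longlonglongrightarrow> (1 + 0) powr p - 1"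
      by (intro tendsto_intros lim_1_over_n) auto
    then have "h \<longlonglongrightarrow> 0 + 0"
      unfolding h_def by (intro tendsto_add tendsto_rabs_zero s_lim) auto
    moreover have i_lim: "filterlim i at_top sequentially"
      unfolding filterlim_at_top
    proof
      fix j
      show "\<forall>\<^sub>F N in sequentially. j \<le> i N"
      proof (rule eventually_sequentiallyI[of "K j"])
        fix N assume "K j \<le> N"
        then have "ln (real (K j)) \<le> ln (real N)" using K_pos[of j] by simp
        then have "(real j powr p) powr (1 / p) \<le> ln (real N) powr (1 / p)"
          using ln_K[of j] p by (intro powr_mono2) auto
        then have "real j \<le> ln (real N) powr (1 / p)" using p by (simp add: powr_powr)
        then show "j \<le> i N" unfolding i_def by (simp add: le_nat_floor)
      qed
    qed
    ultimately have "(\<lambda>N. h (i N)) \<longlonglongrightarrow> 0"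
      by (auto intro: filterlim_compose)
    moreover have "\<forall>\<^sub>F N in sequentially. norm (log_average (\<lambda>n. \<xi> n \<omega>) N) \<le> h (i N)"
      using filterlim_at_top[THEN iffD1, OF i_lim, rule_format, of 1] eventually_ge_at_top[of 1]
    proof eventually_elim
      case (elim N)
      let ?i = "i N"
      have ln0: "0 \<le> ln (real N)" using elim by simp
      have i_le: "real ?i \<le> ln (real N) powr (1 / p)" and i_gt: "ln (real N) powr (1 / p) < real ?i + 1"
        unfolding i_def by (simp_all add: of_nat_floor)
      have root: "(ln (real N) powr (1 / p)) powr p = ln (real N)"
        using ln0 p by (simp add: powr_powr)
      have low: "real ?i powr p \<le> ln (real N)"
        using powr_mono2[OF _ _ i_le, of p] p root by simp
      have up: "ln (real N) \<le> (real ?i + 1) powr p"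
        using powr_mono2[OF _ _ less_imp_le[OF i_gt], of p] p root by simp
      have "exp (real ?i powr p) \<le> real N"
        using low elim by (simp add: ln_ge_iff)
      then have KN: "K ?i \<le> N" unfolding K_def by (simp add: nat_le_iff ceiling_le_iff)
      have ipos: "0 < real ?i powr p" using elim by simp
      have "\<bar>log_average (\<lambda>n. \<xi> n \<omega>) N\<bar>
          \<le> \<bar>s ?i \<omega>\<bar> + (ln (real N) - ln (real (K ?i))) / tlog (real (K ?i))"
        unfolding s_def using K_pos[of ?i] KN by (intro abs_log_average_gap bnd) auto
      also have "(ln (real N) - ln (real (K ?i))) / tlog (real (K ?i))
          \<le> ((real ?i + 1) powr p - real ?i powr p) / real ?i powr p"
        using up ln_K[of ?i] tlog_K[of ?i] ipos p
        by (intro frac_le) (auto intro!: powr_mono2)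
      also have "\<dots> = (1 + 1 / real ?i) powr p - 1"
      proof -
        have "1 + 1 / real ?i = (real ?i + 1) / real ?i"
          using elim by (simp add: field_simps)
        then show ?thesis using ipos elim by (simp add: powr_divide diff_divide_distrib)
      qed
      finally show ?case by (simp add: h_def)
    qed
    ultimately show ?case by (rule Lim_null_comparison[rotated])
  qed
qed

text \<open>Expand the square into a double sum with weights \<open>1 / (k * l)\<close>. For a fixed \<open>k\<close>, the indices \<open>l\<close>
within logarithmic distance \<open>V * T powr a\<close> of \<open>k\<close> have total weight of order \<open>T powr a\<close>, and there the
trivial bound 1 on the correlation is enough. All remaining indices together have weight at most
\<open>2 * T\<close>, which the decorrelation bound \<open>D / T\<close> cancels.\<close>

lemma (in prob_space) second_moment_le_of_decorrelation:
  fixes \<xi> :: "nat \<Rightarrow> 'a \<Rightarrow> real"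
  assumes meas: "\<And>n. \<xi> n \<in> borel_measurable M" and bnd: "\<And>n \<omega>. \<bar>\<xi> n \<omega>\<bar> \<le> 1"
    and nonneg: "0 \<le> a" "0 \<le> V" "0 \<le> D"
    and far: "\<And>k l. 1 \<le> k \<Longrightarrow> k < l \<Longrightarrow> l \<le> N \<Longrightarrow>
      V * tlog (real N) powr a < ln (real l) - ln (real k) \<Longrightarrow>
      \<bar>expectation (\<lambda>\<omega>. \<xi> k \<omega> * \<xi> l \<omega>)\<bar> \<le> D / tlog (real N)"
  shows "expectation (\<lambda>\<omega>. (\<Sum>n=1..N. 1 / real n * \<xi> n \<omega>)\<^sup>2)
    \<le> 2 * (1 + 2 * V + 2 * D) * tlog (real N) powr (1 + a)"
proof -
  note [measurable] = meas
  define T where "T = tlog (real N)"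
  have T: "1 \<le> T" "0 < T" by (simp_all add: T_def tlog_ge_1 tlog_pos)
  define r where "r k l = expectation (\<lambda>\<omega>. \<xi> k \<omega> * \<xi> l \<omega>)" for k l
  have prod_bnd: "\<bar>\<xi> k \<omega> * \<xi> l \<omega>\<bar> \<le> 1" for k l \<omega>
    using mult_mono[OF bnd bnd, of k \<omega> l \<omega>] by (simp add: abs_mult mult.commute)
  have int: "integrable M (\<lambda>\<omega>. \<xi> k \<omega> * \<xi> l \<omega>)" for k l
    by (rule integrable_const_bound[where B = 1]) (use prod_bnd in auto)
  have r_le_1: "\<bar>r k l\<bar> \<le> 1" for k l
  proof -
    have "\<bar>r k l\<bar> \<le> expectation (\<lambda>\<omega>. \<bar>\<xi> k \<omega> * \<xi> l \<omega>\<bar>)"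
      unfolding r_def by (rule integral_abs_bound)
    also have "\<dots> \<le> 1"
      using int prod_bnd by (intro integral_le_const) auto
    finally show ?thesis .
  qed
  have r_sym: "r k l = r l k" for k l unfolding r_def by (simp add: mult.commute)
  have r_far: "\<bar>r k l\<bar> \<le> D / T"
    if kl: "k \<in> {1..N}" "l \<in> {1..N}" and "V * T powr a < \<bar>ln (real l) - ln (real k)\<bar>" for k l
  proof (cases k l rule: linorder_cases)
    case less
    then have "ln (real k) \<le> ln (real l)" using kl by auto
    then show ?thesis using far[of k l] less that by (simp add: r_def T_def)
  next
    case equal
    then show ?thesis using that nonneg T by (simp add: mult_less_0_iff)
  next
    case greater
    then have "ln (real l) \<le> ln (real k)" using kl by auto
    then show ?thesis using far[of l k] greater that r_sym[of k l] by (simp add: r_def T_def)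
  qed
  have row: "(\<Sum>l=1..N. 1 / real l * \<bar>r k l\<bar>) \<le> (1 + 2 * V + 2 * D) * T powr a"
    if k: "k \<in> {1..N}" for k
  proof -
    define near where "near = {l \<in> {1..N}. \<bar>ln (real l) - ln (real k)\<bar> \<le> V * T powr a}"
    have split: "1 / real l * \<bar>r k l\<bar>
        \<le> (if l \<in> near then 1 / real l else 0) + 1 / real l * (D / T)" if "l \<in> {1..N}" for l
    proof (cases "l \<in> near")
      case True
      have "1 / real l * \<bar>r k l\<bar> \<le> 1 / real l * 1"
        by (intro mult_left_mono r_le_1) simp
      moreover have "0 \<le> 1 / real l * (D / T)" using nonneg T by simp
      ultimately show ?thesis using True by simp
    next
      case False
      then have "\<bar>r k l\<bar> \<le> D / T" using that by (intro r_far k) (auto simp: near_def)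
      then have "1 / real l * \<bar>r k l\<bar> \<le> 1 / real l * (D / T)"
        by (intro mult_left_mono) simp_all
      then show ?thesis using False by simp
    qed
    have "(\<Sum>l=1..N. 1 / real l * \<bar>r k l\<bar>)
        \<le> (\<Sum>l=1..N. (if l \<in> near then 1 / real l else 0) + 1 / real l * (D / T))"
      by (intro sum_mono split)
    also have "\<dots> = (\<Sum>l\<in>near. 1 / real l) + (\<Sum>l=1..N. 1 / real l) * (D / T)"
    proof -
      have "(\<Sum>l=1..N. if l \<in> near then 1 / real l else 0) = (\<Sum>l\<in>near. 1 / real l)"
        by (subst sum.inter_restrict[symmetric]) (auto simp: near_def intro!: sum.cong)
      then show ?thesis by (simp only: sum.distrib sum_distrib_right)
    qed
    also have "\<dots> \<le> (1 + 2 * V * T powr a) + 2 * T * (D / T)"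
    proof (intro add_mono mult_right_mono)
      show "(\<Sum>l\<in>near. 1 / real l) \<le> 1 + 2 * V * T powr a"
      proof (rule harmonic_sum_le_spread)
        fix i j assume "i \<in> near" "j \<in> near"
        then have "\<bar>ln (real i) - ln (real k)\<bar> \<le> V * T powr a"
          "\<bar>ln (real j) - ln (real k)\<bar> \<le> V * T powr a" by (auto simp: near_def)
        then show "ln (real j) - ln (real i) \<le> 2 * V * T powr a" by linarith
      qed (use nonneg in \<open>auto simp: near_def\<close>)
      show "(\<Sum>l=1..N. 1 / real l) \<le> 2 * T" unfolding T_def by (rule harmonic_sum_le_tlog)
    qed (use nonneg T in auto)
    also have "\<dots> = (1 + 2 * D) * 1 + 2 * V * T powr a" using T by (simp add: field_simps)
    also have "\<dots> \<le> (1 + 2 * D) * T powr a + 2 * V * T powr a"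
      using nonneg T by (intro add_right_mono mult_left_mono ge_one_powr_ge_zero) auto
    finally show ?thesis by (simp add: algebra_simps)
  qed
  have "expectation (\<lambda>\<omega>. (\<Sum>n=1..N. 1 / real n * \<xi> n \<omega>)\<^sup>2)
      = expectation (\<lambda>\<omega>. \<Sum>k=1..N. \<Sum>l=1..N. (1 / real k * (1 / real l)) * (\<xi> k \<omega> * \<xi> l \<omega>))"
    by (simp add: power2_eq_square sum_product mult.commute mult.left_commute)
  also have "\<dots> = (\<Sum>k=1..N. \<Sum>l=1..N. (1 / real k * (1 / real l)) * r k l)"
    unfolding r_def using int by simp
  also have "\<dots> \<le> (\<Sum>k=1..N. \<Sum>l=1..N. (1 / real k * (1 / real l)) * \<bar>r k l\<bar>)"
    by (intro sum_mono mult_left_mono) auto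
  also have "\<dots> = (\<Sum>k=1..N. 1 / real k * (\<Sum>l=1..N. 1 / real l * \<bar>r k l\<bar>))"
    by (simp add: sum_distrib_left mult.assoc)
  also have "\<dots> \<le> (\<Sum>k=1..N. 1 / real k * ((1 + 2 * V + 2 * D) * T powr a))"
    by (intro sum_mono mult_left_mono row) auto
  also have "\<dots> = (\<Sum>k=1..N. 1 / real k) * ((1 + 2 * V + 2 * D) * T powr a)"
    by (simp only: sum_distrib_right)
  also have "\<dots> \<le> 2 * T * ((1 + 2 * V + 2 * D) * T powr a)"
    unfolding T_def using nonneg by (intro mult_right_mono harmonic_sum_le_tlog) auto
  also have "\<dots> = 2 * (1 + 2 * V + 2 * D) * T powr (1 + a)"
    using T by (simp add: powr_add)
  finally show ?thesis by (simp add: T_def)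
qed

section \<open>Covariances and decoupling\<close>

text \<open>If \<open>V\<close> is replaced by a variable \<open>V'\<close> independent of \<open>U\<close>, the covariance vanishes; the Lipschitz
bound measures what the replacement costs.\<close>

lemma (in prob_space) abs_covariance_le_of_decoupling:
  fixes f :: "real \<Rightarrow> real" and U V V' :: "'a \<Rightarrow> real"
  assumes [measurable]: "U \<in> borel_measurable M" "V \<in> borel_measurable M"
      "f \<in> borel_measurable borel"
    and f: "\<And>u. 0 \<le> f u" "\<And>u. f u \<le> 1"
    and lip: "\<And>u v. \<bar>f u - f v\<bar> \<le> L * \<bar>u - v\<bar>"
    and ind: "indep_var borel U borel V'"
    and int: "integrable M (\<lambda>\<omega>. \<bar>V \<omega> - V' \<omega>\<bar>)"
  shows "\<bar>expectation (\<lambda>\<omega>. (f (U \<omega>) - expectation (\<lambda>\<omega>. f (U \<omega>))) *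
            (f (V \<omega>) - expectation (\<lambda>\<omega>. f (V \<omega>))))\<bar>
    \<le> L * expectation (\<lambda>\<omega>. \<bar>V \<omega> - V' \<omega>\<bar>)"
proof -
  have V' [measurable]: "V' \<in> borel_measurable M" by (rule indep_var_rv2[OF ind])
  have int_f: "integrable M (\<lambda>\<omega>. f (W \<omega>))" if [measurable]: "W \<in> borel_measurable M" for W
    by (rule integrable_const_bound[where B = 1]) (use f in auto)
  define m where "m = expectation (\<lambda>\<omega>. f (U \<omega>))"
  define A where "A \<omega> = f (U \<omega>) - m" for \<omega>
  have [measurable]: "A \<in> borel_measurable M" unfolding A_def by measurable
  have m: "0 \<le> m" "m \<le> 1"
    unfolding m_def using f int_f[of U] by (auto intro: integral_nonneg integral_le_const)
  have A_bnd: "\<bar>A \<omega>\<bar> \<le> 1" for \<omega>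
    using f[of "U \<omega>"] m by (auto simp: A_def abs_le_iff intro: order_trans)
  have int_A: "integrable M A" unfolding A_def using int_f[of U] by auto
  have EA: "expectation A = 0"
    unfolding A_def using int_f[of U] by (simp add: m_def prob_space)
  have int_AW: "integrable M (\<lambda>\<omega>. A \<omega> * f (W \<omega>))" if [measurable]: "W \<in> borel_measurable M" for W
  proof (rule integrable_const_bound[where B = 1])
    show "AE \<omega> in M. norm (A \<omega> * f (W \<omega>)) \<le> 1"
      using A_bnd f by (intro AE_I2) (simp add: abs_mult mult_le_one)
  qed simp
  have ind': "indep_var borel A borel (\<lambda>\<omega>. f (V' \<omega>))"
    using indep_var_compose[OF ind, of "\<lambda>u. f u - m" borel f borel]
    by (simp add: comp_def A_def[abs_def])
  have vanish: "expectation (\<lambda>\<omega>. A \<omega> * f (V' \<omega>)) = 0"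
    using indep_var_lebesgue_integral[OF ind' int_A int_f[OF V']] EA by simp
  have "expectation (\<lambda>\<omega>. A \<omega> * (f (V \<omega>) - expectation (\<lambda>\<omega>. f (V \<omega>))))
      = expectation (\<lambda>\<omega>. A \<omega> * f (V \<omega>) - A \<omega> * expectation (\<lambda>\<omega>. f (V \<omega>)))"
    by (simp add: right_diff_distrib)
  also have "\<dots> = expectation (\<lambda>\<omega>. A \<omega> * f (V \<omega>))"
    using int_A int_AW[of V] EA by (simp add: Bochner_Integration.integral_diff)
  also have "\<dots> = expectation (\<lambda>\<omega>. A \<omega> * f (V \<omega>) - A \<omega> * f (V' \<omega>))"
    using int_AW[of V] int_AW[of V'] vanish by simp
  finally have "\<bar>expectation (\<lambda>\<omega>. A \<omega> * (f (V \<omega>) - expectation (\<lambda>\<omega>. f (V \<omega>))))\<bar>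
      \<le> expectation (\<lambda>\<omega>. \<bar>A \<omega> * f (V \<omega>) - A \<omega> * f (V' \<omega>)\<bar>)"
    by (simp only: integral_abs_bound)
  also have "\<dots> \<le> expectation (\<lambda>\<omega>. L * \<bar>V \<omega> - V' \<omega>\<bar>)"
  proof (rule integral_mono)
    show "\<bar>A \<omega> * f (V \<omega>) - A \<omega> * f (V' \<omega>)\<bar> \<le> L * \<bar>V \<omega> - V' \<omega>\<bar>" for \<omega>
    proof -
      have "\<bar>A \<omega> * f (V \<omega>) - A \<omega> * f (V' \<omega>)\<bar> = \<bar>A \<omega>\<bar> * \<bar>f (V \<omega>) - f (V' \<omega>)\<bar>"
        by (simp add: abs_mult flip: right_diff_distrib)
      also have "\<dots> \<le> 1 * (L * \<bar>V \<omega> - V' \<omega>\<bar>)"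
        by (intro mult_mono A_bnd lip) auto
      finally show ?thesis by simp
    qed
  qed (use int int_AW[of V] int_AW[of V'] in auto)
  finally show ?thesis by (simp add: A_def m_def)
qed

text \<open>A Lipschitz substitute for the indicator of a half line: 1 up to \<open>x\<close>, 0 from \<open>y\<close> on, and linear in
between.\<close>

definition ramp :: "real \<Rightarrow> real \<Rightarrow> real \<Rightarrow> real" where
  "ramp x y u = max 0 (min 1 ((y - u) / (y - x)))"

lemma ramp_bounds: "0 \<le> ramp x y u" "ramp x y u \<le> 1"
  by (auto simp: ramp_def)

lemma ramp_measurable [measurable]: "ramp x y \<in> borel_measurable borel"
  unfolding ramp_def[abs_def] by measurable

lemma ramp_lipschitz:
  assumes "x < y"
  shows "\<bar>ramp x y u - ramp x y v\<bar> \<le> 1 / (y - x) * \<bar>u - v\<bar>"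
proof -
  have "\<bar>ramp x y u - ramp x y v\<bar> \<le> \<bar>(y - u) / (y - x) - (y - v) / (y - x)\<bar>"
    unfolding ramp_def by (auto simp: max_def min_def abs_if)
  also have "\<dots> = 1 / (y - x) * \<bar>u - v\<bar>"
    using assms by (simp add: abs_minus_commute flip: diff_divide_distrib)
  finally show ?thesis .
qed

lemma of_bool_le_ramp: "x < y \<Longrightarrow> of_bool (u \<le> x) \<le> ramp x y u"
  by (auto simp: ramp_def field_simps max_def min_def)

lemma ramp_le_of_bool: "x < y \<Longrightarrow> ramp x y u \<le> of_bool (u \<le> y)"
  by (auto simp: ramp_def field_simps max_def min_def)

section \<open>Growth of the norming sequence\<close>

text \<open>The growth hypothesis says that \<open>n \<mapsto> d n / n powr \<gamma>\<close> is almost increasing from \<open>n0\<close> on. The finitely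
many earlier values are positive and finite, so they only worsen the constant.\<close>

lemma regular_growth_all_indices:
  fixes d :: "nat \<Rightarrow> real"
  assumes pos: "\<And>n. 1 \<le> n \<Longrightarrow> 0 < d n" and "1 \<le> n0" and "0 < c"
    and growth: "\<And>k l. n0 \<le> k \<Longrightarrow> k \<le> l \<Longrightarrow> c * (real l / real k) powr \<gamma> \<le> d l / d k"
  obtains A where "0 < A"
    "\<And>k l. 1 \<le> k \<Longrightarrow> k \<le> l \<Longrightarrow> d k \<le> A * d l * (real k / real l) powr \<gamma>"
proof -
  define g where "g n = d n / real n powr \<gamma>" for n
  have g_pos: "0 < g n" if "1 \<le> n" for n using pos[OF that] that by (simp add: g_def)
  have g_growth: "c * g k \<le> g l" if "n0 \<le> k" "k \<le> l" for k l
    using growth[OF that] pos[of k] pos[of l] that \<open>1 \<le> n0\<close>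
    by (simp add: g_def powr_divide field_simps)
  define B where "B = Max (g ` {1..n0})"
  define b where "b = min (c * g n0) (Min (g ` {1..n0}))"
  have B: "g k \<le> B" if "1 \<le> k" "k \<le> n0" for k using that by (auto simp: B_def)
  have b_le: "b \<le> g l" if "1 \<le> l" for l
  proof (cases "l \<le> n0")
    case True
    then show ?thesis using that by (auto simp: b_def intro!: min.coboundedI2)
  next
    case False
    then show ?thesis using g_growth[of n0 l] by (simp add: b_def)
  qed
  have b: "0 < b"
    using \<open>1 \<le> n0\<close> \<open>0 < c\<close> g_pos by (auto simp: b_def)
  have B_pos: "0 < B" using B[of 1] g_pos[of 1] \<open>1 \<le> n0\<close> by simp
  define A where "A = max (1 / c) (B / b)"
  have "0 < A" using \<open>0 < c\<close> by (simp add: A_def less_max_iff_disj)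
  moreover have "d k \<le> A * d l * (real k / real l) powr \<gamma>" if kl: "1 \<le> k" "k \<le> l" for k l
  proof -
    have "g k \<le> A * g l"
    proof (cases "n0 \<le> k")
      case True
      then have "g k \<le> 1 / c * g l" using g_growth[of k l] kl \<open>0 < c\<close> by (simp add: field_simps)
      also have "\<dots> \<le> A * g l"
        using g_pos[of l] kl by (intro mult_right_mono) (auto simp: A_def)
      finally show ?thesis .
    next
      case False
      have "g k \<le> B / b * b" using B[of k] False kl b by simp
      also have "\<dots> \<le> A * g l"
        using b_le[of l] kl b B_pos by (intro mult_mono) (auto simp: A_def le_max_iff_disj)
      finally show ?thesis .
    qed
    then show ?thesis using kl by (simp add: g_def powr_divide field_simps)
  qed
  ultimately show ?thesis by (rule that)
qed

text \<open>Here \<open>u\<close> is the logarithmic distance of two indices. A distance of order \<open>T powr a\<close> makes the factor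
\<open>exp (- \<gamma> * u)\<close> absorb both the moment bound \<open>exp (\<gamma>' * T powr a)\<close> and any fixed power of \<open>T\<close>, since
\<open>ln T \<le> T powr a / a\<close>; the term \<open>2 / a\<close> pays for two powers of \<open>T\<close>.\<close>

lemma exp_powr_decay_beats_reciprocal:
  fixes T a \<gamma> \<gamma>' u :: real
  assumes "1 \<le> T" "0 < a" "0 < \<gamma>" and u: "(\<gamma>' + 2 / a) / \<gamma> * T powr a < u"
  shows "exp (- \<gamma> * u) * exp (\<gamma>' * T powr a) * T \<le> 1 / T"
proof -
  have "\<gamma>' * T powr a + 2 * ln T \<le> \<gamma>' * T powr a + 2 * (T powr a / a)"
    using ln_powr_bound[of T a] assms by simp
  also have "\<dots> = \<gamma> * ((\<gamma>' + 2 / a) / \<gamma> * T powr a)"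
    using assms by (simp add: field_simps)
  also have "\<dots> \<le> \<gamma> * u" using assms by (intro mult_left_mono) auto
  finally have "- \<gamma> * u + \<gamma>' * T powr a \<le> - 2 * ln T" by simp
  then have "exp (- \<gamma> * u + \<gamma>' * T powr a) \<le> exp (- 2 * ln T)" by simp
  also have "\<dots> = 1 / (T * T)"
    using assms by (simp add: exp_minus exp_double power2_eq_square inverse_eq_divide)
  finally have "exp (- \<gamma> * u) * exp (\<gamma>' * T powr a) \<le> 1 / (T * T)" 
    by (simp only: exp_add)
  then have "exp (- \<gamma> * u) * exp (\<gamma>' * T powr a) * T \<le> 1 / (T * T) * T"
    using assms by (intro mult_right_mono) auto
  then show ?thesis using assms by simp
qed

section \<open>Separating past and future in sums of means\<close>

definition centred_sum :: "(nat \<Rightarrow> 'a \<Rightarrow> real) \<Rightarrow> real \<Rightarrow> nat \<Rightarrow> 'a \<Rightarrow> real" where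
  "centred_sum Y \<mu> n \<omega> = partial_sum Y n \<omega> - \<mu> * real n"

text \<open>What remains of the sum of the centred means up to \<open>L\<close> when the variables with index at most \<open>m\<close> are
replaced by the constant \<open>\<mu>\<close>. It depends on the later variables only, so it is the natural decoupled
version of the sum.\<close>

definition innovation_sum ::
  "(nat \<Rightarrow> 'a \<Rightarrow> real) \<Rightarrow> real \<Rightarrow> nat \<Rightarrow> nat \<Rightarrow> 'a \<Rightarrow> real" where
  "innovation_sum Y \<mu> m L \<omega> =
     (\<Sum>j\<in>{m<..L}. ((\<Sum>i\<in>{m<..j}. Y i \<omega>) - \<mu> * (real j - real m)) / real j)"

lemma mean_sum_decomposition:
  assumes "m \<le> L"
  shows "(\<Sum>k=1..L. partial_sum Y k \<omega> / real k - \<mu>) - innovation_sum Y \<mu> m L \<omega>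
    = (\<Sum>j=1..m. centred_sum Y \<mu> j \<omega> / real j)
      + centred_sum Y \<mu> m \<omega> * (\<Sum>j\<in>{m<..L}. 1 / real j)"
proof -
  have ivl: "{1..L} = {1..m} \<union> {m<..L}" using assms by auto
  have "(\<Sum>k=1..L. partial_sum Y k \<omega> / real k - \<mu>)
      = (\<Sum>j=1..L. centred_sum Y \<mu> j \<omega> / real j)"
    by (intro sum.cong) (auto simp: centred_sum_def field_simps)
  also have "\<dots> = (\<Sum>j=1..m. centred_sum Y \<mu> j \<omega> / real j)
      + (\<Sum>j\<in>{m<..L}. centred_sum Y \<mu> j \<omega> / real j)"
    unfolding ivl by (rule sum.union_disjoint) auto
  also have "(\<Sum>j\<in>{m<..L}. centred_sum Y \<mu> j \<omega> / real j)
      = (\<Sum>j\<in>{m<..L}. centred_sum Y \<mu> m \<omega> * (1 / real j)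
          + ((\<Sum>i\<in>{m<..j}. Y i \<omega>) - \<mu> * (real j - real m)) / real j)"
  proof (rule sum.cong)
    fix j assume "j \<in> {m<..L}"
    then have "{1..j} = {1..m} \<union> {m<..j}" by auto
    then have "partial_sum Y j \<omega> = partial_sum Y m \<omega> + (\<Sum>i\<in>{m<..j}. Y i \<omega>)"
      unfolding partial_sum_def by (simp add: sum.union_disjoint ivl_disj_int)
    then show "centred_sum Y \<mu> j \<omega> / real j = centred_sum Y \<mu> m \<omega> * (1 / real j)
          + ((\<Sum>i\<in>{m<..j}. Y i \<omega>) - \<mu> * (real j - real m)) / real j"
      by (simp add: centred_sum_def algebra_simps flip: add_divide_distrib)
  qed simp
  finally show ?thesis
    by (simp only: sum.distrib sum_distrib_left innovation_sum_def)
qed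

text \<open>By \<open>mean_sum_decomposition\<close> the past enters through the means up to \<open>m\<close> and through the last centred
sum, which persists with weight \<open>1 / j\<close> in every later mean. Both kinds of terms carry harmonic
weights, so a uniform bound \<open>B\<close> on the first moments costs only a harmonic sum.\<close>

lemma (in prob_space) mean_sum_minus_innovation:
  assumes "m \<le> L"
    and int: "\<And>j. 1 \<le> j \<Longrightarrow> j \<le> m \<Longrightarrow> integrable M (centred_sum Y \<mu> j)"
    and bnd: "\<And>j. 1 \<le> j \<Longrightarrow> j \<le> m \<Longrightarrow> expectation (\<lambda>\<omega>. \<bar>centred_sum Y \<mu> j \<omega>\<bar>) \<le> B"
    and "0 \<le> B"
  shows "integrable M (\<lambda>\<omega>. \<bar>(\<Sum>k=1..L. partial_sum Y k \<omega> / real k - \<mu>)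
      - innovation_sum Y \<mu> m L \<omega>\<bar>)" (is "integrable M (\<lambda>\<omega>. \<bar>?X \<omega>\<bar>)")
    and "expectation (\<lambda>\<omega>. \<bar>(\<Sum>k=1..L. partial_sum Y k \<omega> / real k - \<mu>)
      - innovation_sum Y \<mu> m L \<omega>\<bar>) \<le> B * (\<Sum>j=1..L. 1 / real j)"
proof -
  let ?T = "centred_sum Y \<mu>"
  define H where "H = (\<Sum>j\<in>{m<..L}. 1 / real j)"
  have H: "0 \<le> H" unfolding H_def by (intro sum_nonneg) auto
  have T0: "?T 0 = (\<lambda>_. 0)" by (simp add: fun_eq_iff centred_sum_def partial_sum_def)
  have int_m: "integrable M (?T m)" using int[of m] T0 by (cases "m = 0") auto
  have bnd_m: "expectation (\<lambda>\<omega>. \<bar>?T m \<omega>\<bar>) \<le> B" using bnd[of m] T0 \<open>0 \<le> B\<close> by (cases "m = 0") auto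
  have X: "?X \<omega> = (\<Sum>j=1..m. ?T j \<omega> / real j) + ?T m \<omega> * H" for \<omega>
    unfolding H_def by (rule mean_sum_decomposition[OF \<open>m \<le> L\<close>])
  show int_X: "integrable M (\<lambda>\<omega>. \<bar>?X \<omega>\<bar>)"
    unfolding X using int int_m
    by (intro integrable_abs Bochner_Integration.integrable_add Bochner_Integration.integrable_sum)
       auto
  have "expectation (\<lambda>\<omega>. \<bar>?X \<omega>\<bar>)
      \<le> expectation (\<lambda>\<omega>. (\<Sum>j=1..m. \<bar>?T j \<omega>\<bar> / real j) + \<bar>?T m \<omega>\<bar> * H)"
  proof (rule integral_mono)
    show "integrable M (\<lambda>\<omega>. (\<Sum>j=1..m. \<bar>?T j \<omega>\<bar> / real j) + \<bar>?T m \<omega>\<bar> * H)"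
      using int int_m
      by (intro Bochner_Integration.integrable_add Bochner_Integration.integrable_sum) auto
    show "\<bar>?X \<omega>\<bar> \<le> (\<Sum>j=1..m. \<bar>?T j \<omega>\<bar> / real j) + \<bar>?T m \<omega>\<bar> * H" for \<omega>
    proof -
      have "\<bar>\<Sum>j=1..m. ?T j \<omega> / real j\<bar> \<le> (\<Sum>j=1..m. \<bar>?T j \<omega>\<bar> / real j)"
        using sum_abs[of "\<lambda>j. ?T j \<omega> / real j" "{1..m}"] by simp
      moreover have "\<bar>?T m \<omega> * H\<bar> = \<bar>?T m \<omega>\<bar> * H" using H by (simp add: abs_mult)
      moreover have "?X \<omega> = (\<Sum>j=1..m. ?T j \<omega> / real j) + ?T m \<omega> * H" by (rule X)
      ultimately show ?thesis by linarith
    qed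
  qed (rule int_X)
  also have "\<dots> = (\<Sum>j=1..m. expectation (\<lambda>\<omega>. \<bar>?T j \<omega>\<bar>) / real j)
      + expectation (\<lambda>\<omega>. \<bar>?T m \<omega>\<bar>) * H"
    using int int_m by (subst Bochner_Integration.integral_add) auto
  also have "\<dots> \<le> (\<Sum>j=1..m. B / real j) + B * H"
    using bnd bnd_m H by (intro add_mono sum_mono mult_right_mono divide_right_mono) auto
  also have "\<dots> = B * (\<Sum>j=1..L. 1 / real j)"
  proof -
    have "{1..L} = {1..m} \<union> {m<..L}" using \<open>m \<le> L\<close> by auto
    then have "(\<Sum>j=1..L. 1 / real j) = (\<Sum>j=1..m. 1 / real j) + H"
      unfolding H_def by (simp add: sum.union_disjoint ivl_disj_int)
    then show ?thesis by (simp add: distrib_left sum_distrib_left)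
  qed
  finally show "expectation (\<lambda>\<omega>. \<bar>?X \<omega>\<bar>) \<le> B * (\<Sum>j=1..L. 1 / real j)" .
qed

text \<open>The first sum is a function of the variables with index at most \<open>m\<close>, the second one of the variables
with index above \<open>m\<close>.\<close>

lemma (in prob_space) indep_mean_sum_innovation:
  assumes ind: "indep_vars (\<lambda>_. borel) Y {1..}"
  shows "indep_var borel (\<lambda>\<omega>. c * (\<Sum>k=1..m. partial_sum Y k \<omega> / real k - \<mu>))
    borel (\<lambda>\<omega>. c' * innovation_sum Y \<mu> m L \<omega>)"
proof -
  define F where "F = (\<lambda>y::nat \<Rightarrow> real. c * (\<Sum>k=1..m. (\<Sum>i=1..k. y i) / real k - \<mu>))"
  define F' where "F' = (\<lambda>y::nat \<Rightarrow> real. c' * (\<Sum>j\<in>{m<..L}.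
      ((\<Sum>i\<in>{m<..j}. y i) - \<mu> * (real j - real m)) / real j))"
  have "F \<in> borel_measurable (PiM {1..m} (\<lambda>_. borel))"
    unfolding F_def by (intro borel_measurable_times borel_measurable_sum borel_measurable_diff
      borel_measurable_divide borel_measurable_const measurable_component_singleton) auto
  moreover have "F' \<in> borel_measurable (PiM {m<..L} (\<lambda>_. borel))"
    unfolding F'_def by (intro borel_measurable_times borel_measurable_sum borel_measurable_diff
      borel_measurable_divide borel_measurable_const measurable_component_singleton) auto
  ultimately have "indep_var borel (F \<circ> (\<lambda>\<omega>. restrict (\<lambda>i. Y i \<omega>) {1..m}))
      borel (F' \<circ> (\<lambda>\<omega>. restrict (\<lambda>i. Y i \<omega>) {m<..L}))"
    by (intro indep_var_compose[OF indep_var_restrict[OF ind]]) auto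
  moreover have "F \<circ> (\<lambda>\<omega>. restrict (\<lambda>i. Y i \<omega>) {1..m})
      = (\<lambda>\<omega>. c * (\<Sum>k=1..m. partial_sum Y k \<omega> / real k - \<mu>))"
  proof
    fix \<omega>
    have "(\<Sum>i=1..k. restrict (\<lambda>i. Y i \<omega>) {1..m} i) = partial_sum Y k \<omega>" if "k \<in> {1..m}" for k
      using that unfolding partial_sum_def by (intro sum.cong) auto
    then show "(F \<circ> (\<lambda>\<omega>. restrict (\<lambda>i. Y i \<omega>) {1..m})) \<omega>
        = c * (\<Sum>k=1..m. partial_sum Y k \<omega> / real k - \<mu>)"
      unfolding F_def comp_def by (intro arg_cong[where f = "(*) c"] sum.cong refl) (simp only:)
  qed
  moreover have "F' \<circ> (\<lambda>\<omega>. restrict (\<lambda>i. Y i \<omega>) {m<..L})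
      = (\<lambda>\<omega>. c' * innovation_sum Y \<mu> m L \<omega>)"
  proof
    fix \<omega>
    have "(\<Sum>i\<in>{m<..j}. restrict (\<lambda>i. Y i \<omega>) {m<..L} i) = (\<Sum>i\<in>{m<..j}. Y i \<omega>)"
      if "j \<in> {m<..L}" for j
      using that by (intro sum.cong) auto
    then show "(F' \<circ> (\<lambda>\<omega>. restrict (\<lambda>i. Y i \<omega>) {m<..L})) \<omega> = c' * innovation_sum Y \<mu> m L \<omega>"
      unfolding F'_def comp_def innovation_sum_def
      by (intro arg_cong[where f = "(*) c'"] sum.cong refl) (simp only:)
  qed
  ultimately show ?thesis by simp
qed

section \<open>Almost sure equivalence for ramp functions\<close>

lemma (in prob_space) partial_sum_measurable:
  assumes "indep_vars (\<lambda>_. borel) Y {1..}"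
  shows "partial_sum Y n \<in> borel_measurable M"
proof -
  have "Y i \<in> borel_measurable M" if "1 \<le> i" for i
    using assms that by (auto simp: indep_vars_def)
  then show ?thesis
    unfolding partial_sum_def[abs_def] by (intro borel_measurable_sum) auto
qed

lemma (in prob_space) normalized_mean_sum_measurable:
  assumes "indep_vars (\<lambda>_. borel) Y {1..}"
  shows "normalized_mean_sum Y \<mu> d t n \<in> borel_measurable M"
  unfolding normalized_mean_sum_def[abs_def]
  using partial_sum_measurable[OF assms] by measurable

text \<open>This is the probabilistic core. Let \<open>k < l \<le> N\<close> and \<open>T = tlog N\<close>. Removing from \<open>X l\<close> the variables on
which \<open>X k\<close> depends changes it in mean by at most a constant times
\<open>(k / l) powr \<gamma> * exp (\<gamma>' * T powr a) * T\<close>: the first factor is the growth of \<open>d\<close>, the second one the moment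
hypothesis, the third one a harmonic sum. This is \<open>O(1 / T)\<close> as soon as \<open>l\<close> is at logarithmic distance
more than \<open>V * T powr a\<close> from \<open>k\<close>, which is the decorrelation that the second moment bound requires.\<close>

lemma (in prob_space) AE_log_average_ramp_centred:
  fixes Y :: "nat \<Rightarrow> 'a \<Rightarrow> real" and d :: "nat \<Rightarrow> real" and \<mu> t :: real
  defines "X \<equiv> normalized_mean_sum Y \<mu> d t"
  assumes ind: "indep_vars (\<lambda>_. borel) Y {1..}"
    and pos: "\<And>n. 1 \<le> n \<Longrightarrow> 0 < d n"
    and growth: "\<And>k l. 1 \<le> k \<Longrightarrow> k \<le> l \<Longrightarrow> d k \<le> A * d l * (real k / real l) powr \<gamma>"
    and int: "\<And>n. 1 \<le> n \<Longrightarrow> integrable M (centred_sum Y \<mu> n)"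
    and moment: "\<And>n. 1 \<le> n \<Longrightarrow> expectation (\<lambda>\<omega>. \<bar>centred_sum Y \<mu> n \<omega>\<bar>)
        \<le> C * d n * exp (\<gamma>' * tlog (real n) powr a)"
    and const: "0 < a" "a < 1" "0 < \<gamma>" "0 \<le> \<gamma>'" "0 \<le> A" "0 \<le> C"
    and t: "0 \<le> t" "t \<le> 1" and "x < y"
  shows "AE \<omega> in M. log_average
    (\<lambda>n. ramp x y (X n \<omega>) - expectation (\<lambda>\<omega>. ramp x y (X n \<omega>))) \<longlonglongrightarrow> 0"
proof -
  have [measurable]: "X n \<in> borel_measurable M" for n
    unfolding X_def by (rule normalized_mean_sum_measurable[OF ind])
  define f where "f = ramp x y"
  have [measurable]: "f \<in> borel_measurable borel" unfolding f_def by measurable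
  have f_bnd: "0 \<le> f u" "f u \<le> 1" for u by (simp_all add: f_def ramp_bounds)
  define \<xi> where "\<xi> n \<omega> = f (X n \<omega>) - expectation (\<lambda>\<omega>. f (X n \<omega>))" for n \<omega>
  have \<xi>_meas: "\<xi> n \<in> borel_measurable M" for n unfolding \<xi>_def by measurable
  have \<xi>_bnd: "\<bar>\<xi> n \<omega>\<bar> \<le> 1" for n \<omega>
  proof -
    have "integrable M (\<lambda>\<omega>. f (X n \<omega>))"
      by (rule integrable_const_bound[where B = 1]) (use f_bnd in auto)
    then have "0 \<le> expectation (\<lambda>\<omega>. f (X n \<omega>))" "expectation (\<lambda>\<omega>. f (X n \<omega>)) \<le> 1"
      using f_bnd by (auto intro: integral_nonneg integral_le_const)
    then show ?thesis
      using f_bnd[of "X n \<omega>"] unfolding \<xi>_def by linarith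
  qed
  define V where "V = (\<gamma>' + 2 / a) / \<gamma>"
  define D where "D = 2 * A * C / (y - x)"
  have V: "0 \<le> V" and D: "0 \<le> D" using const \<open>x < y\<close> by (auto simp: V_def D_def)
  have far: "\<bar>expectation (\<lambda>\<omega>. \<xi> k \<omega> * \<xi> l \<omega>)\<bar> \<le> D / tlog (real N)"
    if kl: "1 \<le> k" "k < l" "l \<le> N"
      and sep: "V * tlog (real N) powr a < ln (real l) - ln (real k)" for N k l
  proof -
    define T where "T = tlog (real N)"
    have T: "1 \<le> T" "0 < T" by (simp_all add: T_def tlog_ge_1 tlog_pos)
    have dl: "0 < d l" using pos kl by simp
    define m n where "m = nat \<lfloor>real k * t\<rfloor>" and "n = nat \<lfloor>real l * t\<rfloor>"
    have "real k * t \<le> real l * t" using kl t by (intro mult_right_mono) auto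
    then have "m \<le> n" unfolding m_def n_def by (intro nat_mono floor_mono)
    have "real k * t \<le> real k" "real l * t \<le> real l" using t by (simp_all add: mult_left_le)
    then have "m \<le> k" "n \<le> l" unfolding m_def n_def by linarith+
    define q where "q = (real k / real l) powr \<gamma>"
    define B where "B = C * (A * d l * q) * exp (\<gamma>' * T powr a)"
    have B: "0 \<le> B" using const dl by (simp add: B_def q_def)
    have "expectation (\<lambda>\<omega>. \<bar>centred_sum Y \<mu> j \<omega>\<bar>) \<le> B" if j: "1 \<le> j" "j \<le> m" for j
    proof -
      have "d j \<le> A * d l * (real j / real l) powr \<gamma>" using growth[of j l] j \<open>m \<le> k\<close> kl by simp
      also have "\<dots> \<le> A * d l * q"
        unfolding q_def using j \<open>m \<le> k\<close> kl const dl
        by (intro mult_left_mono powr_mono2 divide_right_mono) auto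
      finally have "d j \<le> A * d l * q" .
      moreover have "\<gamma>' * tlog (real j) powr a \<le> \<gamma>' * T powr a"
        unfolding T_def using j \<open>m \<le> k\<close> kl const tlog_pos[of "real j"]
        by (intro mult_left_mono powr_mono2 tlog_mono) auto
      ultimately have "C * d j * exp (\<gamma>' * tlog (real j) powr a) \<le> B"
        unfolding B_def using const dl pos[OF j(1)]
        by (intro mult_mono mult_nonneg_nonneg) (auto simp: q_def)
      then show ?thesis using moment[OF j(1)] by linarith
    qed
    note rest = mean_sum_minus_innovation[OF \<open>m \<le> n\<close> int this B]
    define X' where "X' = (\<lambda>\<omega>. 1 / d l * innovation_sum Y \<mu> m n \<omega>)"
    have X_eq: "X k = (\<lambda>\<omega>. 1 / d k * (\<Sum>j=1..m. partial_sum Y j \<omega> / real j - \<mu>))"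
      "X l = (\<lambda>\<omega>. 1 / d l * (\<Sum>j=1..n. partial_sum Y j \<omega> / real j - \<mu>))"
      by (simp_all add: X_def normalized_mean_sum_def[abs_def] m_def n_def)
    have diff: "\<bar>X l \<omega> - X' \<omega>\<bar> = 1 / d l *
        \<bar>(\<Sum>j=1..n. partial_sum Y j \<omega> / real j - \<mu>) - innovation_sum Y \<mu> m n \<omega>\<bar>" for \<omega>
      using dl by (simp add: X_eq X'_def abs_mult flip: diff_divide_distrib)
    have ind': "indep_var borel (X k) borel X'"
      unfolding X_eq X'_def by (rule indep_mean_sum_innovation[OF ind])
    have lip: "\<bar>f u - f v\<bar> \<le> 1 / (y - x) * \<bar>u - v\<bar>" for u v
      unfolding f_def by (rule ramp_lipschitz[OF \<open>x < y\<close>])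
    have "\<bar>expectation (\<lambda>\<omega>. \<xi> k \<omega> * \<xi> l \<omega>)\<bar>
        \<le> 1 / (y - x) * expectation (\<lambda>\<omega>. \<bar>X l \<omega> - X' \<omega>\<bar>)"
      unfolding \<xi>_def
    proof (rule abs_covariance_le_of_decoupling[OF _ _ _ f_bnd lip ind'])
      show "integrable M (\<lambda>\<omega>. \<bar>X l \<omega> - X' \<omega>\<bar>)"
        unfolding diff by (intro integrable_mult_right rest(1))
    qed simp_all
    also have "expectation (\<lambda>\<omega>. \<bar>X l \<omega> - X' \<omega>\<bar>) \<le> 1 / d l * (B * (2 * T))"
    proof -
      have "(\<Sum>j=1..n. 1 / real j) \<le> 2 * tlog (real n)" by (rule harmonic_sum_le_tlog)
      also have "\<dots> \<le> 2 * T" using \<open>n \<le> l\<close> kl by (simp add: T_def tlog_mono)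
      finally have "B * (\<Sum>j=1..n. 1 / real j) \<le> B * (2 * T)" using B by (rule mult_left_mono)
      then show ?thesis
        unfolding diff using rest(2) dl by (simp add: divide_right_mono)
    qed
    also have "1 / d l * (B * (2 * T)) = 2 * A * C * (q * exp (\<gamma>' * T powr a) * T)"
      using dl by (simp add: B_def)
    also have "q = exp (- \<gamma> * (ln (real l) - ln (real k)))"
      using kl by (simp add: q_def powr_def ln_div algebra_simps)
    also have "2 * A * C * (exp (- \<gamma> * (ln (real l) - ln (real k))) * exp (\<gamma>' * T powr a) * T)
        \<le> 2 * A * C * (1 / T)"
      using const T sep by (intro mult_left_mono exp_powr_decay_beats_reciprocal) (auto simp: T_def V_def)
    finally show ?thesis using \<open>x < y\<close>
      by (simp add: D_def T_def mult_left_mono divide_right_mono)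
  qed
  have "AE \<omega> in M. log_average (\<lambda>n. \<xi> n \<omega>) \<longlonglongrightarrow> 0"
  proof (rule AE_log_average_tendsto_0[OF \<xi>_meas \<xi>_bnd])
    fix N :: nat
    show "expectation (\<lambda>\<omega>. (\<Sum>n=1..N. 1 / real n * \<xi> n \<omega>)\<^sup>2)
        \<le> 2 * (1 + 2 * V + 2 * D) * tlog (real N) powr (2 - (1 - a))"
      using second_moment_le_of_decorrelation[OF \<xi>_meas \<xi>_bnd _ V D far, of a N] const
      by simp
  qed (use const in simp)
  then show ?thesis by (simp add: \<xi>_def f_def)
qed

section \<open>Passage from ramps to indicators\<close>

lemma mono_continuity_point_between:
  fixes G :: "real \<Rightarrow> real"
  assumes "mono G" "x < y"
  obtains z where "x < z" "z < y" "isCont G z"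
proof -
  have "countable {u. \<not> isCont G u}"
    using mono_ctble_discont[OF \<open>mono G\<close>] by (simp add: continuous_at)
  then obtain z where "z \<in> {x<..<y}" "z \<notin> {u. \<not> isCont G u}"
    using real_interval_avoid_countable_set[OF \<open>x < y\<close>] by metis
  then show ?thesis by (intro that[of z]) auto
qed

text \<open>The bounding sequences may depend on the points \<open>y\<close> and \<open>z\<close> and on the tolerance \<open>e\<close>. Since \<open>G\<close> has
continuity points arbitrarily close to \<open>x\<close> on either side, continuity at \<open>x\<close> closes the gap.\<close>

lemma tendsto_of_sandwich_at_continuity_points:
  fixes G :: "real \<Rightarrow> real" and b :: "nat \<Rightarrow> real"
  assumes "mono G" "isCont G x"
    and sandwich: "\<And>y z e. y < x \<Longrightarrow> x < z \<Longrightarrow> isCont G y \<Longrightarrow> isCont G z \<Longrightarrow> 0 < e \<Longrightarrow>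
      \<exists>a a'. a \<longlonglongrightarrow> G y \<and> a' \<longlonglongrightarrow> G z \<and>
        (\<forall>\<^sub>F N in sequentially. a N - e \<le> b N \<and> b N \<le> a' N + e)"
  shows "b \<longlonglongrightarrow> G x"
proof (rule LIMSEQ_I)
  fix r :: real
  assume "0 < r"
  then obtain \<eta> where \<eta>: "0 < \<eta>" "\<And>u. \<bar>u - x\<bar> < \<eta> \<Longrightarrow> \<bar>G u - G x\<bar> < r / 3"
    using \<open>isCont G x\<close> unfolding continuous_at_eps_delta dist_real_def
    by (metis divide_pos_pos zero_less_numeral)
  obtain y where y: "x - \<eta> < y" "y < x" "isCont G y"
    using mono_continuity_point_between[OF \<open>mono G\<close>, of "x - \<eta>" x] \<eta>(1) by auto
  obtain z where z: "x < z" "z < x + \<eta>" "isCont G z"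
    using mono_continuity_point_between[OF \<open>mono G\<close>, of x "x + \<eta>"] \<eta>(1) by auto
  obtain a a' where lim: "a \<longlonglongrightarrow> G y" "a' \<longlonglongrightarrow> G z"
    and between: "\<forall>\<^sub>F N in sequentially. a N - r / 3 \<le> b N \<and> b N \<le> a' N + r / 3"
    using sandwich[OF y(2) z(1) y(3) z(3), of "r / 3"] \<open>0 < r\<close> by auto
  have near: "\<bar>G y - G x\<bar> < r / 3" "\<bar>G z - G x\<bar> < r / 3" using \<eta>(2) y z by auto
  have "\<forall>\<^sub>F N in sequentially. G y - r / 3 < a N" "\<forall>\<^sub>F N in sequentially. a' N < G z + r / 3"
    using lim \<open>0 < r\<close> by (auto intro: order_tendstoD)
  then have "\<forall>\<^sub>F N in sequentially. norm (b N - G x) < r"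
    using between
  proof eventually_elim
    case (elim N)
    then show ?case using near unfolding real_norm_def by linarith
  qed
  then show "\<exists>no. \<forall>N\<ge>no. norm (b N - G x) < r" by (simp add: eventually_sequentially)
qed

text \<open>The comparison of two families of averaged distribution functions that survives smoothing: the
argument on the right may be moved up by any positive amount, and the error vanishes in the limit.\<close>

definition shifted_asymp_le :: "(real \<Rightarrow> nat \<Rightarrow> real) \<Rightarrow> (real \<Rightarrow> nat \<Rightarrow> real) \<Rightarrow> bool" where
  "shifted_asymp_le a b \<longleftrightarrow> (\<forall>x y e. x < y \<longrightarrow> 0 < e \<longrightarrow>
     (\<forall>\<^sub>F N in sequentially. a x N \<le> b y N + e))"

text \<open>The family \<open>a\<close> may depend on \<open>y\<close> and \<open>z\<close>. This matters when \<open>a\<close> is a random family that converges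
at each continuity point outside a null set depending on that point: only two points are needed at a
time, and then some outcome is good for both.\<close>

lemma tendsto_of_shifted_asymp_le:
  fixes G :: "real \<Rightarrow> real"
  assumes "mono G" "isCont G x"
    and witness: "\<And>y z. isCont G y \<Longrightarrow> isCont G z \<Longrightarrow> \<exists>a. shifted_asymp_le a b \<and> shifted_asymp_le b a \<and>
      a y \<longlonglongrightarrow> G y \<and> a z \<longlonglongrightarrow> G z"
  shows "b x \<longlonglongrightarrow> G x"
proof (rule tendsto_of_sandwich_at_continuity_points[OF \<open>mono G\<close> \<open>isCont G x\<close>])
  fix y z e :: real
  assume yz: "y < x" "x < z" "isCont G y" "isCont G z" "0 < e"
  then obtain a where a: "shifted_asymp_le a b" "shifted_asymp_le b a"
    "a y \<longlonglongrightarrow> G y" "a z \<longlonglongrightarrow> G z"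
    using witness by blast
  have "\<forall>\<^sub>F N in sequentially. a y N \<le> b x N + e" "\<forall>\<^sub>F N in sequentially. b x N \<le> a z N + e"
    using a(1,2) yz unfolding shifted_asymp_le_def by blast+
  then have "\<forall>\<^sub>F N in sequentially. a y N - e \<le> b x N \<and> b x N \<le> a z N + e"
    by eventually_elim simp
  then show "\<exists>a a'. a \<longlonglongrightarrow> G y \<and> a' \<longlonglongrightarrow> G z \<and>
      (\<forall>\<^sub>F N in sequentially. a N - e \<le> b x N \<and> b x N \<le> a' N + e)"
    using a(3,4) by blast
qed

text \<open>Rational ramps suffice because two rationals fit between any \<open>x < y\<close>. So the comparison
of uncountably many arguments rests on countably many limits, which is what an almost sure statement
can afford.\<close>

lemma shifted_asymp_le_of_ramps:
  fixes F H :: "real \<Rightarrow> real \<Rightarrow> nat \<Rightarrow> real" and p q :: "nat \<Rightarrow> real \<Rightarrow> real"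
  assumes mono: "\<And>n x y. x \<le> y \<Longrightarrow> p n x \<le> p n y" "\<And>n x y. x \<le> y \<Longrightarrow> q n x \<le> q n y"
    and lower: "\<And>x y n. x < y \<Longrightarrow> p n x \<le> F x y n" and upper: "\<And>x y n. x < y \<Longrightarrow> H x y n \<le> q n y"
    and lim: "\<And>x y. x \<in> \<rat> \<Longrightarrow> y \<in> \<rat> \<Longrightarrow> x < y \<Longrightarrow> log_average (\<lambda>n. F x y n - H x y n) \<longlonglongrightarrow> 0"
  shows "shifted_asymp_le (\<lambda>x. log_average (\<lambda>n. p n x)) (\<lambda>x. log_average (\<lambda>n. q n x))"
  unfolding shifted_asymp_le_def
proof (intro allI impI)
  fix x y e :: real
  assume "x < y" "0 < e"
  obtain r where r: "r \<in> \<rat>" "x < r" "r < y" using Rats_dense_in_real[OF \<open>x < y\<close>] by auto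
  obtain s where s: "s \<in> \<rat>" "r < s" "s < y" using Rats_dense_in_real[OF \<open>r < y\<close>] by auto
  have "\<forall>\<^sub>F N in sequentially. log_average (\<lambda>n. F r s n - H r s n) N < e"
    using lim[OF r(1) s(1,2)] \<open>0 < e\<close> by (rule order_tendstoD)
  then show "\<forall>\<^sub>F N in sequentially.
      log_average (\<lambda>n. p n x) N \<le> log_average (\<lambda>n. q n y) N + e"
  proof eventually_elim
    case (elim N)
    have "log_average (\<lambda>n. p n x) N \<le> log_average (F r s) N"
      using mono(1)[of x r] lower[of r s] r s
      by (intro log_average_mono) (meson less_imp_le order_trans)
    moreover have "log_average (H r s) N \<le> log_average (\<lambda>n. q n y) N"
      using mono(2)[of s y] upper[of r s] r s
      by (intro log_average_mono) (meson less_imp_le order_trans)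
    ultimately show ?case using elim by (simp add: log_average_diff)
  qed
qed

section \<open>The equivalence\<close>

theorem theorem3:
  fixes M :: "'a measure"
    and Y :: "nat \<Rightarrow> 'a \<Rightarrow> real"
    and d :: "nat \<Rightarrow> real"
    and \<gamma> \<gamma>' \<epsilon> \<mu> t :: real
    and n0 :: nat
    and G :: "real \<Rightarrow> real"
  assumes "prob_space M"
    and "prob_space.indep_vars M (\<lambda>_. borel) Y {1..}"
    and "\<And>n. n \<ge> 1 \<Longrightarrow> d n > 0"
    and "\<gamma> > 0" and "n0 \<ge> 1"
    and "\<exists>c>0. \<forall>k l. n0 \<le> k \<and> k \<le> l \<longrightarrow>
           d l / d k \<ge> c * (real l / real k) powr \<gamma>"
    and "0 < \<gamma>'" and "\<gamma>' < \<gamma>" and "\<epsilon> > 0"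
    and "\<exists>C. \<forall>n\<ge>1.
           integrable M (\<lambda>\<omega>. \<bar>(partial_sum Y n \<omega> - \<mu> * real n) / d n\<bar>) \<and>
           (\<integral>\<omega>. \<bar>(partial_sum Y n \<omega> - \<mu> * real n) / d n\<bar> \<partial>M)
             \<le> C * exp (\<gamma>' * tlog (real n) powr (1 - \<epsilon>))"
    and "t \<in> {0..1}"
    and "right_continuous_mono G 0 1"
  shows "(\<forall>x. isCont G x \<longrightarrow>
            (AE \<omega> in M. log_average (\<lambda>n. of_bool (normalized_mean_sum Y \<mu> d t n \<omega> \<le> x))
                          \<longlonglongrightarrow> G x))
     \<longleftrightarrow> (\<forall>x. isCont G x \<longrightarrow>
            log_average (\<lambda>n. \<P>(\<omega> in M. normalized_mean_sum Y \<mu> d t n \<omega> \<le> x))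
              \<longlonglongrightarrow> G x)"
proof -
  interpret prob_space M by fact
  define X where "X = normalized_mean_sum Y \<mu> d t"
  have G: "mono G" using \<open>right_continuous_mono G 0 1\<close> by (rule right_continuous_mono.mono)
  have pos: "\<And>n. 1 \<le> n \<Longrightarrow> 0 < d n" by fact
  obtain A where A: "0 < A"
    and growth: "\<And>k l. 1 \<le> k \<Longrightarrow> k \<le> l \<Longrightarrow> d k \<le> A * d l * (real k / real l) powr \<gamma>"
  proof -
    from assms(6) obtain c where "0 < c"
      "\<And>k l. n0 \<le> k \<Longrightarrow> k \<le> l \<Longrightarrow> c * (real l / real k) powr \<gamma> \<le> d l / d k"
      by blast
    then show thesis
      using regular_growth_all_indices[of d n0 c \<gamma>] pos \<open>n0 \<ge> 1\<close> that by blast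
  qed
  obtain C where C: "\<And>n. n \<ge> 1 \<Longrightarrow> integrable M (\<lambda>\<omega>. \<bar>centred_sum Y \<mu> n \<omega> / d n\<bar>)"
    "\<And>n. n \<ge> 1 \<Longrightarrow> expectation (\<lambda>\<omega>. \<bar>centred_sum Y \<mu> n \<omega> / d n\<bar>)
        \<le> C * exp (\<gamma>' * tlog (real n) powr (1 - \<epsilon>))"
    using assms(10) unfolding centred_sum_def by blast
  \<comment> \<open>Raising the exponent \<open>1 - \<epsilon>\<close> only weakens the moment hypothesis, because \<open>tlog\<close> is at least 1. It
    brings the exponent into \<open>{0<..<1}\<close> also when \<open>\<epsilon> \<ge> 1\<close>.\<close>
  define a where "a = max (1 - \<epsilon>) (1 / 2)"
  have a: "0 < a" "a < 1" using \<open>\<epsilon> > 0\<close> by (auto simp: a_def)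
  have int: "integrable M (centred_sum Y \<mu> n)" if "1 \<le> n" for n
  proof -
    have [measurable]: "centred_sum Y \<mu> n \<in> borel_measurable M"
      unfolding centred_sum_def[abs_def]
      by (intro borel_measurable_diff partial_sum_measurable[OF assms(2)]) simp
    have "integrable M (\<lambda>\<omega>. centred_sum Y \<mu> n \<omega> / d n)"
      using C(1)[OF that] by (rule integrable_abs_cancel) measurable
    then have "integrable M (\<lambda>\<omega>. d n * (centred_sum Y \<mu> n \<omega> / d n))"
      by (rule integrable_mult_right)
    moreover have "(\<lambda>\<omega>. d n * (centred_sum Y \<mu> n \<omega> / d n)) = centred_sum Y \<mu> n"
      using pos[OF that] by (simp add: fun_eq_iff)
    ultimately show ?thesis by (simp only:)
  qed
  have moment: "expectation (\<lambda>\<omega>. \<bar>centred_sum Y \<mu> n \<omega>\<bar>)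
      \<le> \<bar>C\<bar> * d n * exp (\<gamma>' * tlog (real n) powr a)" if "1 \<le> n" for n
  proof -
    have "expectation (\<lambda>\<omega>. \<bar>centred_sum Y \<mu> n \<omega>\<bar>) / d n
        = expectation (\<lambda>\<omega>. \<bar>centred_sum Y \<mu> n \<omega> / d n\<bar>)"
      using pos[OF that] by simp
    also have "\<dots> \<le> C * exp (\<gamma>' * tlog (real n) powr (1 - \<epsilon>))" by (rule C(2)[OF that])
    also have "\<dots> \<le> \<bar>C\<bar> * exp (\<gamma>' * tlog (real n) powr a)"
      using \<open>0 < \<gamma>'\<close> by (intro mult_mono) (auto simp: a_def intro!: tlog_powr_mono)
    finally show ?thesis using pos[OF that] by (simp add: field_simps)
  qed
  have centred: "AE \<omega> in M. log_average
      (\<lambda>n. ramp x y (X n \<omega>) - expectation (\<lambda>\<omega>. ramp x y (X n \<omega>))) \<longlonglongrightarrow> 0"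
    if "x < y" for x y
    unfolding X_def
    by (rule AE_log_average_ramp_centred[OF assms(2) pos growth int moment])
       (use that a A assms in auto)
  have [measurable]: "X n \<in> borel_measurable M" for n
    unfolding X_def by (rule normalized_mean_sum_measurable[OF assms(2)])
  define freq where "freq \<omega> x = log_average (\<lambda>n. of_bool (X n \<omega> \<le> x))" for \<omega> x
  define mean where "mean x = log_average (\<lambda>n. \<P>(\<omega> in M. X n \<omega> \<le> x))" for x
  have AE_le: "AE \<omega> in M. shifted_asymp_le (freq \<omega>) mean \<and> shifted_asymp_le mean (freq \<omega>)"
  proof -
    have "AE \<omega> in M. \<forall>x\<in>\<rat>. \<forall>y\<in>\<rat>. x < y \<longrightarrow> log_average
        (\<lambda>n. ramp x y (X n \<omega>) - expectation (\<lambda>\<omega>. ramp x y (X n \<omega>))) \<longlonglongrightarrow> 0"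
      using centred by (simp add: AE_ball_countable countable_rat)
    then show ?thesis
    proof eventually_elim
      case (elim \<omega>)
      have int_ramp: "integrable M (\<lambda>\<omega>. ramp x y (X n \<omega>))" for x y n
        by (rule integrable_const_bound[where B = 1]) (use ramp_bounds in auto)
      have prob_eq: "\<P>(\<omega> in M. X n \<omega> \<le> x) = expectation (\<lambda>\<omega>. of_bool (X n \<omega> \<le> x))" for n x
      proof -
        have "expectation (\<lambda>\<omega>. of_bool (X n \<omega> \<le> x) :: real)
            = expectation (indicator {\<omega> \<in> space M. X n \<omega> \<le> x})"
          by (intro Bochner_Integration.integral_cong) (auto simp: indicator_def)
        also have "\<dots> = \<P>(\<omega> in M. X n \<omega> \<le> x)" by simp
        finally show ?thesis by simp
      qed
      have int_bool: "integrable M (\<lambda>\<omega>. of_bool (X n \<omega> \<le> x) :: real)" for n x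
        by (rule integrable_const_bound[where B = 1]) auto
      have prob_le: "\<P>(\<omega> in M. X n \<omega> \<le> x) \<le> expectation (\<lambda>\<omega>. ramp x y (X n \<omega>))"
        and le_prob: "expectation (\<lambda>\<omega>. ramp x y (X n \<omega>)) \<le> \<P>(\<omega> in M. X n \<omega> \<le> y)"
        if "x < y" for x y n
        unfolding prob_eq using int_ramp int_bool that
        by (auto intro!: integral_mono of_bool_le_ramp ramp_le_of_bool)
      have prob_mono: "\<P>(\<omega> in M. X n \<omega> \<le> x) \<le> \<P>(\<omega> in M. X n \<omega> \<le> y)" if "x \<le> y" for n x y
        using that by (intro finite_measure_mono) auto
      have bool_mono: "(of_bool (X n \<omega> \<le> x) :: real) \<le> of_bool (X n \<omega> \<le> y)" if "x \<le> y" for n x y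
        using that by auto
      have "shifted_asymp_le (freq \<omega>) mean"
        unfolding freq_def mean_def
        by (rule shifted_asymp_le_of_ramps[where F = "\<lambda>x y n. ramp x y (X n \<omega>)"
            and H = "\<lambda>x y n. expectation (\<lambda>\<omega>. ramp x y (X n \<omega>))"])
           (use elim bool_mono prob_mono le_prob of_bool_le_ramp in auto)
      moreover have "shifted_asymp_le mean (freq \<omega>)"
        unfolding freq_def mean_def
      proof (rule shifted_asymp_le_of_ramps[where H = "\<lambda>x y n. ramp x y (X n \<omega>)"
            and F = "\<lambda>x y n. expectation (\<lambda>\<omega>. ramp x y (X n \<omega>))"])
        fix x y :: real
        assume "x \<in> \<rat>" "y \<in> \<rat>" "x < y"
        then have "log_average
            (\<lambda>n. ramp x y (X n \<omega>) - expectation (\<lambda>\<omega>. ramp x y (X n \<omega>))) \<longlonglongrightarrow> 0"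
          using elim by blast
        from tendsto_minus[OF this]
        show "log_average
            (\<lambda>n. expectation (\<lambda>\<omega>. ramp x y (X n \<omega>)) - ramp x y (X n \<omega>)) \<longlonglongrightarrow> 0"
          by (simp add: log_average_diff[abs_def])
      qed (use bool_mono prob_mono prob_le ramp_le_of_bool in auto)
      ultimately show ?case by blast
    qed
  qed
  have "(\<forall>x. isCont G x \<longrightarrow> (AE \<omega> in M. freq \<omega> x \<longlonglongrightarrow> G x))
      \<longleftrightarrow> (\<forall>x. isCont G x \<longrightarrow> mean x \<longlonglongrightarrow> G x)"
  proof (intro iffI allI impI)
    fix x
    assume freq: "\<forall>x. isCont G x \<longrightarrow> (AE \<omega> in M. freq \<omega> x \<longlonglongrightarrow> G x)" and "isCont G x"
    show "mean x \<longlonglongrightarrow> G x"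
    proof (rule tendsto_of_shifted_asymp_le[OF G \<open>isCont G x\<close>])
      fix y z
      assume "isCont G y" "isCont G z"
      then have "AE \<omega> in M. shifted_asymp_le (freq \<omega>) mean \<and> shifted_asymp_le mean (freq \<omega>) \<and>
          freq \<omega> y \<longlonglongrightarrow> G y \<and> freq \<omega> z \<longlonglongrightarrow> G z"
        using AE_le freq by (auto intro: AE_conjI)
      then show "\<exists>a. shifted_asymp_le a mean \<and> shifted_asymp_le mean a \<and>
          a y \<longlonglongrightarrow> G y \<and> a z \<longlonglongrightarrow> G z"
        using eventually_happens'[OF ae_filter_bot] by blast
    qed
  next
    fix x
    assume mean: "\<forall>x. isCont G x \<longrightarrow> mean x \<longlonglongrightarrow> G x" and "isCont G x"
    from AE_le show "AE \<omega> in M. freq \<omega> x \<longlonglongrightarrow> G x"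
    proof eventually_elim
      case (elim \<omega>)
      then show ?case using mean
        by (intro tendsto_of_shifted_asymp_le[OF G \<open>isCont G x\<close>]) blast
    qed
  qed
  then show ?thesis by (simp only: freq_def mean_def X_def)
qed

end
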